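(* Let $(\Omega,\Sigma,\mu)$ be a finite measure space, $X$ a Banach space, and let $f:\Omega\to X$ be Bochner-integrable. Then $f$ is RL-integrable and its RL-integral equals its Bochner integral.
   Context: RL-integrability: a partition of a measurable set $A\subset\Omega$ is a countable family $\Pi=\{\Delta_i\}$ of pairwise disjoint measurable sets with union $A$ (finite families are allowed). A set of sampling points for $\Pi$ is $T=\{t_i\}$ with $t_i\in\Delta_i$. Put $S(f,\Pi,T)=\sum_i f(t_i)\mu(\Delta_i)$. Write $\Gamma\succ\Pi$ ($\Gamma$ is finer than $\Pi$) if every member of $\Pi$ is a union of members of $\Gamma$. A function $f:\Omega\to X$ is RL-integrable over $A$, with RL-integral $x\in X$ (written $\int_A f\,d\mu=x$), if for every $\epsilon>0$ there is a partition $\Pi$ of $A$ such that for every $\Gamma\succ\Pi$ and every set $T$ of sampling points for $\Gamma$, the series $S(f,\Gamma,T)$ converges absolutely and $\|S(f,\Gamma,T)-x\|<\epsilon$. RL-integrable without further qualification means RL-integrable over $\Omega$. *)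

theory Defs
  imports "HOL-Analysis.Analysis"
begin

section \<open>Bochner integral in an arbitrary Banach space\<close>

text \<open>
  The library predicates \<open>has_bochner_integral\<close> and \<open>integrable\<close> require a second countable (that is,
  separable) target space. The classical definition needs no such restriction: \<open>f\<close> is strongly
  measurable, and there are simple functions \<open>s i\<close> with \<open>\<integral>\<^sup>+x. norm (f x - s i x) \<partial>M \<longlonglongrightarrow> 0\<close>; the
  integral is then the limit of the integrals of any such sequence. The functions
  \<open>norm (f x - s i x)\<close> are measurable only up to a null set; \<open>nn_integral\<close> is insensitive to
  changes on null sets, so it still has the intended value.
\<close>

definition strongly_measurable :: "'a measure \<Rightarrow> ('a \<Rightarrow> 'b::banach) \<Rightarrow> bool" where
  "strongly_measurable M f \<longleftrightarrow>
     (\<exists>s. (\<forall>i. simple_function M (s i)) \<and> (AE x in M. (\<lambda>i. s i x) \<longlonglongrightarrow> f x))"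

definition bochner_approx :: "'a measure \<Rightarrow> ('a \<Rightarrow> 'b::banach) \<Rightarrow> (nat \<Rightarrow> 'a \<Rightarrow> 'b) \<Rightarrow> bool" where
  "bochner_approx M f s \<longleftrightarrow>
     (\<forall>i. Bochner_Integration.simple_bochner_integrable M (s i)) \<and>
     (\<lambda>i. \<integral>\<^sup>+x. ennreal (norm (f x - s i x)) \<partial>M) \<longlonglongrightarrow> 0"

definition bochner_integrable :: "'a measure \<Rightarrow> ('a \<Rightarrow> 'b::banach) \<Rightarrow> bool" where
  "bochner_integrable M f \<longleftrightarrow> strongly_measurable M f \<and> (\<exists>s. bochner_approx M f s)"

definition bochner_integral :: "'a measure \<Rightarrow> ('a \<Rightarrow> 'b::banach) \<Rightarrow> 'b" where
  "bochner_integral M f =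
     (THE x. \<forall>s. bochner_approx M f s \<longrightarrow> (\<lambda>i. Bochner_Integration.simple_bochner_integral M (s i)) \<longlonglongrightarrow> x)"

lemma simple_bochner_integral_dist_le:
  fixes f :: "'a \<Rightarrow> 'b::banach"
  assumes f: "strongly_measurable M f"
    and s: "Bochner_Integration.simple_bochner_integrable M s" and t: "Bochner_Integration.simple_bochner_integrable M t"
  shows "ennreal (norm (Bochner_Integration.simple_bochner_integral M s - Bochner_Integration.simple_bochner_integral M t)) \<le>
    (\<integral>\<^sup>+x. norm (f x - s x) \<partial>M) + (\<integral>\<^sup>+x. norm (f x - t x) \<partial>M)"
proof -
  obtain u where u: "\<And>i. simple_function M (u i)" and lim: "AE x in M. (\<lambda>i. u i x) \<longlonglongrightarrow> f x"
    using f unfolding strongly_measurable_def by blast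
  have sf: "simple_function M s" "simple_function M t"
    using s t by (auto elim: simple_bochner_integrable.cases)
  define g where "g r = (\<lambda>x. liminf (\<lambda>i. ennreal (norm (u i x - r x))))" for r :: "'a \<Rightarrow> 'b"
  have g_meas: "g r \<in> borel_measurable M" if "simple_function M r" for r
  proof -
    have "(\<lambda>x. ennreal (norm (u i x - r x))) \<in> borel_measurable M" for i
      by (rule borel_measurable_simple_function, rule simple_function_compose2[OF u that])
    then show ?thesis unfolding g_def by (rule borel_measurable_liminf)
  qed
  have g_eq: "AE x in M. ennreal (norm (f x - r x)) = g r x" for r
    using lim
  proof eventually_elim
    case (elim x)
    then have "(\<lambda>i. ennreal (norm (u i x - r x))) \<longlonglongrightarrow> ennreal (norm (f x - r x))"
      by (intro tendsto_intros)
    from lim_imp_Liminf[OF sequentially_bot this] show ?case unfolding g_def by (rule sym)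
  qed
  have "ennreal (norm (Bochner_Integration.simple_bochner_integral M s - Bochner_Integration.simple_bochner_integral M t)) =
      norm (Bochner_Integration.simple_bochner_integral M (\<lambda>x. s x - t x))"
    using s t by (subst simple_bochner_integral_diff) auto
  also have "\<dots> \<le> Bochner_Integration.simple_bochner_integral M (\<lambda>x. norm (s x - t x))"
    using simple_bochner_integrable_compose2[of "(-)" M "s" "t"] s t
    by (auto intro!: simple_bochner_integral_norm_bound)
  also have "\<dots> = (\<integral>\<^sup>+x. norm (s x - t x) \<partial>M)"
    using simple_bochner_integrable_compose2[of "\<lambda>x y. norm (x - y)" M "s" "t"] s t
    by (auto intro!: simple_bochner_integral_eq_nn_integral)
  also have "\<dots> \<le> (\<integral>\<^sup>+x. g s x + g t x \<partial>M)"
  proof (rule nn_integral_mono_AE)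
    show "AE x in M. ennreal (norm (s x - t x)) \<le> g s x + g t x"
      using g_eq[of s] g_eq[of t]
    proof eventually_elim
      case (elim x)
      have "norm (s x - t x) \<le> norm (f x - s x) + norm (f x - t x)"
        by (metis dual_order.refl norm_diff_triangle_le norm_minus_commute)
      then show ?case
        unfolding elim[symmetric] by (metis ennreal_leI ennreal_plus norm_ge_zero)
    qed
  qed
  also have "\<dots> = (\<integral>\<^sup>+x. g s x \<partial>M) + (\<integral>\<^sup>+x. g t x \<partial>M)"
    by (intro nn_integral_add g_meas sf)
  also have "\<dots> = (\<integral>\<^sup>+x. norm (f x - s x) \<partial>M) + (\<integral>\<^sup>+x. norm (f x - t x) \<partial>M)"
    using nn_integral_cong_AE[OF g_eq[of s]] nn_integral_cong_AE[OF g_eq[of t]] by simp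
  finally show ?thesis .
qed

text \<open>For integrable \<open>f\<close> the definite description is well-defined.\<close>

lemma bochner_integral_tendsto:
  fixes f :: "'a \<Rightarrow> 'b::banach"
  assumes f: "strongly_measurable M f" and s: "bochner_approx M f s"
  shows "(\<lambda>i. Bochner_Integration.simple_bochner_integral M (s i)) \<longlonglongrightarrow> bochner_integral M f"
proof -
  let ?I = "\<lambda>r i. Bochner_Integration.simple_bochner_integral M (r i)"
  let ?E = "\<lambda>r i. \<integral>\<^sup>+x. ennreal (norm (f x - r i x)) \<partial>M"
  have small: "\<exists>N. \<forall>i\<ge>N. \<forall>j\<ge>N. dist (?I r i) (?I r' j) < e"
    if r: "bochner_approx M f r" and r': "bochner_approx M f r'" and e: "0 < e" for r r' e
  proof -
    have "eventually (\<lambda>i. ?E r i < ennreal (e/2)) sequentially"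
      using r e unfolding bochner_approx_def by (intro order_tendstoD(2)[of _ 0]) auto
    moreover have "eventually (\<lambda>i. ?E r' i < ennreal (e/2)) sequentially"
      using r' e unfolding bochner_approx_def by (intro order_tendstoD(2)[of _ 0]) auto
    ultimately have "eventually (\<lambda>i. ?E r i < ennreal (e/2) \<and> ?E r' i < ennreal (e/2)) sequentially"
      by (rule eventually_conj)
    then obtain N where N: "\<forall>i\<ge>N. ?E r i < ennreal (e/2) \<and> ?E r' i < ennreal (e/2)"
      unfolding eventually_sequentially by blast
    have "dist (?I r i) (?I r' j) < e" if "i \<ge> N" "j \<ge> N" for i j
    proof -
      have "ennreal (norm (?I r i - ?I r' j)) \<le> ?E r i + ?E r' j"
        using r r' by (intro simple_bochner_integral_dist_le f) (auto simp: bochner_approx_def)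
      also have "\<dots> < ennreal (e/2) + ennreal (e/2)"
        using N that by (intro add_strict_mono) auto
      also have "\<dots> = ennreal e"
        using e by (simp flip: ennreal_plus)
      finally show ?thesis using e by (simp add: dist_norm ennreal_less_iff)
    qed
    then show ?thesis by blast
  qed
  have "Cauchy (?I s)"
    using small[OF s s] by (simp add: Cauchy_def)
  then obtain x where x: "?I s \<longlonglongrightarrow> x"
    using Cauchy_convergent convergent_def by blast
  have all: "?I r \<longlonglongrightarrow> x" if r: "bochner_approx M f r" for r
  proof -
    have "(\<lambda>i. ?I r i - ?I s i) \<longlonglongrightarrow> 0"
      unfolding lim_sequentially
    proof (intro allI impI)
      fix e :: real assume "0 < e"
      from small[OF r s this] show "\<exists>N. \<forall>n\<ge>N. dist (?I r n - ?I s n) 0 < e"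
        by (auto simp: dist_norm)
    qed
    from tendsto_add[OF this x] show ?thesis by simp
  qed
  have "bochner_integral M f = x"
    unfolding bochner_integral_def
  proof (rule the_equality)
    show "\<forall>r. bochner_approx M f r \<longrightarrow> ?I r \<longlonglongrightarrow> x" using all by blast
    show "y = x" if "\<forall>r. bochner_approx M f r \<longrightarrow> ?I r \<longlonglongrightarrow> y" for y
      using that s x LIMSEQ_unique by blast
  qed
  with x show ?thesis by simp
qed

text \<open>Over a separable target space this extends the integral of the library.\<close>

lemma bochner_integral_eq_lebesgue_integral:
  fixes f :: "'a \<Rightarrow> 'b::{banach, second_countable_topology}"
  assumes "integrable M f"
  shows "bochner_integrable M f \<and> bochner_integral M f = integral\<^sup>L M f"
proof -
  have "has_bochner_integral M f (integral\<^sup>L M f)"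
    using assms by (rule has_bochner_integral_integrable)
  then obtain s where f: "f \<in> borel_measurable M" and s: "bochner_approx M f s"
    and lim: "(\<lambda>i. Bochner_Integration.simple_bochner_integral M (s i)) \<longlonglongrightarrow> integral\<^sup>L M f"
    by (auto elim!: has_bochner_integral.cases simp: bochner_approx_def)
  have m: "strongly_measurable M f"
    using borel_measurable_implies_sequence_metric[OF f, of 0]
    unfolding strongly_measurable_def by (blast intro: AE_I2)
  show ?thesis
    using m s LIMSEQ_unique[OF bochner_integral_tendsto[OF m s] lim]
    by (auto simp: bochner_integrable_def)
qed

section \<open>The RL-integral\<close>

text \<open>
  A partition is represented by the set of its cells. Empty cells are excluded by
  \<open>partition_on\<close>; they have measure zero and admit no sampling point.
\<close>

definition measurable_partition :: "'a measure \<Rightarrow> 'a set \<Rightarrow> 'a set set \<Rightarrow> bool" where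
  "measurable_partition M A P \<longleftrightarrow> countable P \<and> P \<subseteq> sets M \<and> partition_on A P"

definition finer :: "'a set set \<Rightarrow> 'a set set \<Rightarrow> bool" where
  "finer \<Gamma> P \<longleftrightarrow> (\<forall>D\<in>P. \<exists>G\<subseteq>\<Gamma>. D = \<Union>G)"

definition sampling :: "'a set set \<Rightarrow> ('a set \<Rightarrow> 'a) \<Rightarrow> bool" where
  "sampling P t \<longleftrightarrow> (\<forall>D\<in>P. t D \<in> D)"

definition RL_sum :: "'a measure \<Rightarrow> ('a \<Rightarrow> 'b::banach) \<Rightarrow> 'a set set \<Rightarrow> ('a set \<Rightarrow> 'a) \<Rightarrow> 'b" where
  "RL_sum M f P t = (\<Sum>\<^sub>\<infinity>D\<in>P. measure M D *\<^sub>R f (t D))"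

definition has_RL_integral :: "'a measure \<Rightarrow> 'a set \<Rightarrow> ('a \<Rightarrow> 'b::banach) \<Rightarrow> 'b \<Rightarrow> bool" where
  "has_RL_integral M A f x \<longleftrightarrow>
     (\<forall>\<epsilon>>0. \<exists>P. measurable_partition M A P \<and>
        (\<forall>\<Gamma> t. measurable_partition M A \<Gamma> \<and> finer \<Gamma> P \<and> sampling \<Gamma> t \<longrightarrow>
           (\<lambda>D. measure M D *\<^sub>R f (t D)) abs_summable_on \<Gamma> \<and> norm (RL_sum M f \<Gamma> t - x) < \<epsilon>))"

definition RL_integrable :: "'a measure \<Rightarrow> 'a set \<Rightarrow> ('a \<Rightarrow> 'b::banach) \<Rightarrow> bool" where
  "RL_integrable M A f \<longleftrightarrow> (\<exists>x. has_RL_integral M A f x)"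

definition RL_integral :: "'a measure \<Rightarrow> 'a set \<Rightarrow> ('a \<Rightarrow> 'b::banach) \<Rightarrow> 'b" where
  "RL_integral M A f = (THE x. has_RL_integral M A f x)"

lemma common_refinement:
  assumes P: "measurable_partition M A P" and Q: "measurable_partition M A Q"
  shows "\<exists>\<Gamma>. measurable_partition M A \<Gamma> \<and> finer \<Gamma> P \<and> finer \<Gamma> Q"
proof -
  define \<Gamma> where "\<Gamma> = (\<lambda>(D, E). D \<inter> E) ` (P \<times> Q) - {{}}"
  have UP: "\<Union>P = A" and UQ: "\<Union>Q = A"
    and dP: "\<And>D D'. D \<in> P \<Longrightarrow> D' \<in> P \<Longrightarrow> D \<noteq> D' \<Longrightarrow> D \<inter> D' = {}"
    and dQ: "\<And>D D'. D \<in> Q \<Longrightarrow> D' \<in> Q \<Longrightarrow> D \<noteq> D' \<Longrightarrow> D \<inter> D' = {}"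
    using P Q by (auto simp: measurable_partition_def partition_on_def disjoint_def)
  have "measurable_partition M A \<Gamma>"
    unfolding measurable_partition_def
  proof (intro conjI)
    show "countable \<Gamma>" using P Q by (auto simp: \<Gamma>_def measurable_partition_def)
    show "\<Gamma> \<subseteq> sets M" using P Q by (auto simp: \<Gamma>_def measurable_partition_def)
    show "partition_on A \<Gamma>"
    proof (rule partition_onI)
      show "\<Union>\<Gamma> = A"
      proof
        show "\<Union>\<Gamma> \<subseteq> A" using UP by (auto simp: \<Gamma>_def)
        show "A \<subseteq> \<Union>\<Gamma>"
        proof
          fix x assume "x \<in> A"
          then obtain D E where "D \<in> P" "E \<in> Q" "x \<in> D \<inter> E" using UP UQ by blast
          then show "x \<in> \<Union>\<Gamma>" unfolding \<Gamma>_def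
            by (intro UnionI[of "D \<inter> E"]) (auto intro: image_eqI[of _ _ "(D, E)"])
        qed
      qed
      fix p q assume "p \<in> \<Gamma>" "q \<in> \<Gamma>" "p \<noteq> q"
      then obtain D E D' E' where *: "D \<in> P" "E \<in> Q" "p = D \<inter> E" "D' \<in> P" "E' \<in> Q" "q = D' \<inter> E'"
        by (auto simp: \<Gamma>_def)
      with \<open>p \<noteq> q\<close> have "D \<noteq> D' \<or> E \<noteq> E'" by blast
      with * dP[of D D'] dQ[of E E'] show "disjnt p q" unfolding disjnt_def by blast
    qed (auto simp: \<Gamma>_def)
  qed
  moreover have "finer \<Gamma> P"
    unfolding finer_def
  proof
    fix D assume D: "D \<in> P"
    show "\<exists>G\<subseteq>\<Gamma>. D = \<Union>G"
    proof (intro exI conjI equalityI)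
      show "{G \<in> \<Gamma>. G \<subseteq> D} \<subseteq> \<Gamma>" by blast
      show "D \<subseteq> \<Union>{G \<in> \<Gamma>. G \<subseteq> D}"
      proof
        fix x assume x: "x \<in> D"
        then obtain E where "E \<in> Q" "x \<in> E" using D UP UQ by blast
        with D x have "D \<inter> E \<in> \<Gamma>"
          by (auto simp: \<Gamma>_def intro: image_eqI[of _ _ "(D, E)"])
        with x \<open>x \<in> E\<close> show "x \<in> \<Union>{G \<in> \<Gamma>. G \<subseteq> D}" by blast
      qed
    qed auto
  qed
  moreover have "finer \<Gamma> Q"
    unfolding finer_def
  proof
    fix E assume E: "E \<in> Q"
    show "\<exists>G\<subseteq>\<Gamma>. E = \<Union>G"
    proof (intro exI conjI equalityI)
      show "{G \<in> \<Gamma>. G \<subseteq> E} \<subseteq> \<Gamma>" by blast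
      show "E \<subseteq> \<Union>{G \<in> \<Gamma>. G \<subseteq> E}"
      proof
        fix x assume x: "x \<in> E"
        then obtain D where "D \<in> P" "x \<in> D" using E UP UQ by blast
        with E x have "D \<inter> E \<in> \<Gamma>"
          by (auto simp: \<Gamma>_def intro: image_eqI[of _ _ "(D, E)"])
        with x \<open>x \<in> D\<close> show "x \<in> \<Union>{G \<in> \<Gamma>. G \<subseteq> E}" by blast
      qed
    qed auto
  qed
  ultimately show ?thesis by blast
qed

lemma has_RL_integral_unique:
  assumes "has_RL_integral M A f x" "has_RL_integral M A f y"
  shows "x = y"
proof (rule ccontr)
  assume "x \<noteq> y"
  then have e: "norm (x - y) / 2 > 0" by simp
  obtain P where P: "measurable_partition M A P" and
    Px: "\<And>\<Gamma> t. measurable_partition M A \<Gamma> \<Longrightarrow> finer \<Gamma> P \<Longrightarrow> sampling \<Gamma> t \<Longrightarrow>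
      norm (RL_sum M f \<Gamma> t - x) < norm (x - y) / 2"
    using assms(1) e unfolding has_RL_integral_def by meson
  obtain Q where Q: "measurable_partition M A Q" and
    Qy: "\<And>\<Gamma> t. measurable_partition M A \<Gamma> \<Longrightarrow> finer \<Gamma> Q \<Longrightarrow> sampling \<Gamma> t \<Longrightarrow>
      norm (RL_sum M f \<Gamma> t - y) < norm (x - y) / 2"
    using assms(2) e unfolding has_RL_integral_def by meson
  obtain \<Gamma> where \<Gamma>: "measurable_partition M A \<Gamma>" "finer \<Gamma> P" "finer \<Gamma> Q"
    using common_refinement[OF P Q] by blast
  then have "{} \<notin> \<Gamma>" by (auto simp: measurable_partition_def partition_on_def)
  then have t: "sampling \<Gamma> (\<lambda>D. SOME x. x \<in> D)"
    unfolding sampling_def by (auto simp: some_in_eq)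
  show False
    using Px[OF \<Gamma>(1,2) t] Qy[OF \<Gamma>(1,3) t]
      norm_triangle_ineq4[of "RL_sum M f \<Gamma> (\<lambda>D. SOME x. x \<in> D) - y" "RL_sum M f \<Gamma> (\<lambda>D. SOME x. x \<in> D) - x"]
    by simp
qed

lemma RL_integral_eqI: "has_RL_integral M A f x \<Longrightarrow> RL_integral M A f = x"
  unfolding RL_integral_def by (blast intro: has_RL_integral_unique)

end

theory Submission
  imports Defs
begin

text \<open>
  A strongly measurable function has, off a null set, its values in the closure of a countable set,
  so \<open>space M\<close> splits into countably many measurable cells which are null or on which \<open>f\<close> oscillates
  by at most \<open>\<delta>\<close>. This property passes to finer partitions \<open>\<Gamma>\<close>. For a simple function \<open>s\<close>, split its
  integral over the cells of \<open>\<Gamma>\<close>: this differs from the Riemann sum of \<open>f\<close> over \<open>\<Gamma>\<close> by at most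
  \<open>(\<integral>norm (f x - s x)) + \<delta> * \<mu>(space M)\<close>. Now let \<open>s\<close> run through an approximating sequence.
\<close>

section \<open>Unconditional sums of measures over countable families of sets\<close>

lemma has_sum_sum:
  fixes f :: "'i \<Rightarrow> 'a \<Rightarrow> 'b::topological_comm_monoid_add"
  assumes "\<And>i. i \<in> I \<Longrightarrow> (f i has_sum S i) A"
  shows "((\<lambda>x. \<Sum>i\<in>I. f i x) has_sum (\<Sum>i\<in>I. S i)) A"
  using assms by (induction I rule: infinite_finite_induct) (auto intro: has_sum_add)

text \<open>This is countable additivity, moved from sequences to a family indexed by its own
  members, which is how Riemann sums over a partition are indexed.\<close>

lemma (in finite_measure) has_sum_measure_disjoint:
  assumes "countable \<Gamma>" "\<Gamma> \<subseteq> sets M" "disjoint \<Gamma>"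
  shows "(measure M has_sum measure M (\<Union>\<Gamma>)) \<Gamma>"
proof -
  let ?I = "to_nat_on \<Gamma> ` \<Gamma>"
  \<comment> \<open>Padding with empty sets treats finite and infinite \<open>\<Gamma>\<close>
    alike; the extra terms are zero and drop out of the sum.\<close>
  define A where "A n = (if n \<in> ?I then from_nat_into \<Gamma> n else {})" for n
  have A_to_nat: "A (to_nat_on \<Gamma> D) = D" if "D \<in> \<Gamma>" for D
    using that assms(1) by (simp add: A_def)
  have A_out: "A n = {}" if "n \<notin> ?I" for n
    using that by (auto simp: A_def)
  have A_sets: "range A \<subseteq> sets M"
    using assms(1,2) by (auto simp: A_def)
  have "disjoint_family A"
    unfolding disjoint_family_on_def
  proof (intro ballI impI)
    fix m n :: nat assume "m \<noteq> n"
    show "A m \<inter> A n = {}"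
    proof (cases "m \<in> ?I \<and> n \<in> ?I")
      case True
      then obtain D E where "D \<in> \<Gamma>" "m = to_nat_on \<Gamma> D" "E \<in> \<Gamma>" "n = to_nat_on \<Gamma> E" by blast
      with \<open>m \<noteq> n\<close> assms(3) show ?thesis
        by (metis A_to_nat disjointD)
    qed (use A_out in auto)
  qed
  with A_sets have "(\<lambda>n. measure M (A n)) sums measure M (\<Union>n. A n)"
    by (rule finite_measure_UNION)
  moreover have "(\<Union>n. A n) = \<Union>\<Gamma>"
  proof (intro equalityI subsetI)
    fix x assume "x \<in> (\<Union>n. A n)"
    then obtain n where "x \<in> A n" by blast
    moreover from this have "n \<in> ?I" using A_out by blast
    ultimately show "x \<in> \<Union>\<Gamma>" using A_to_nat by blast
  next
    fix x assume "x \<in> \<Union>\<Gamma>"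
    then show "x \<in> (\<Union>n. A n)" using A_to_nat by blast
  qed
  \<comment> \<open>The terms are nonnegative, so convergence in the given order is already
    unconditional.\<close>
  ultimately have "((\<lambda>n. measure M (A n)) has_sum measure M (\<Union>\<Gamma>)) UNIV"
    by (intro norm_summable_imp_has_sum) (auto simp: sums_iff)
  then have "((\<lambda>n. measure M (A n)) has_sum measure M (\<Union>\<Gamma>)) ?I"
    by (subst has_sum_cong_neutral[where T = UNIV and g = "\<lambda>n. measure M (A n)"])
      (auto simp: A_out)
  then have "((\<lambda>n. measure M (A n)) \<circ> to_nat_on \<Gamma> has_sum measure M (\<Union>\<Gamma>)) \<Gamma>"
    by (simp add: has_sum_reindex[OF inj_on_to_nat_on[OF assms(1)]])
  then show ?thesis
    by (rule has_sum_cong[THEN iffD1, rotated]) (simp add: A_to_nat)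
qed

lemma (in finite_measure) has_sum_measure_partition_Int:
  assumes \<Gamma>: "measurable_partition M (space M) \<Gamma>" and B: "B \<in> sets M"
  shows "((\<lambda>D. measure M (D \<inter> B)) has_sum measure M B) \<Gamma>"
proof -
  \<comment> \<open>Restricting \<open>M\<close> to \<open>B\<close> by a density keeps
    \<open>\<Gamma>\<close> itself as the disjoint family. The sets \<open>D \<inter> B\<close> are
    a poor index, since several of them may be empty and hence coincide.\<close>
  define N where "N = density M (indicator B)"
  have N: "measure N D = measure M (D \<inter> B)" if "D \<in> sets M" for D
    using that B by (simp add: N_def measure_def emeasure_density nn_integral_indicator
        flip: indicator_inter_arith) (simp add: Int_commute)
  interpret N: finite_measure N
    using B by (intro finite_measureI)
      (simp add: N_def emeasure_density emeasure_finite cong: nn_integral_cong_simp)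
  have "(measure N has_sum measure N (\<Union>\<Gamma>)) \<Gamma>"
    using \<Gamma> by (intro N.has_sum_measure_disjoint)
      (auto simp: measurable_partition_def partition_on_def N_def)
  moreover have "\<Union>\<Gamma> = space M"
    using \<Gamma> by (auto simp: measurable_partition_def partition_on_def)
  ultimately have "(measure N has_sum measure M B) \<Gamma>"
    using B by (simp add: N)
  then show ?thesis
    by (rule has_sum_cong[THEN iffD1, rotated])
      (use \<Gamma> N in \<open>auto simp: measurable_partition_def\<close>)
qed

section \<open>Strongly measurable functions and partitions into cells of small oscillation\<close>

text \<open>A limit inferior of measurable functions is measurable whether or not the limit exists,
  and it agrees with the norm wherever the simple functions converge. The result stands in for the
  norm in integrals that must be split or used as a density.\<close>

lemma strongly_measurable_norm_diff_AE_eq: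
  assumes f: "strongly_measurable M f" and r: "simple_function M r"
  obtains g where "g \<in> borel_measurable M" "AE x in M. ennreal (norm (f x - r x)) = g x"
proof -
  obtain u where u: "\<And>i. simple_function M (u i)" and lim: "AE x in M. (\<lambda>i. u i x) \<longlonglongrightarrow> f x"
    using f unfolding strongly_measurable_def by blast
  show thesis
  proof
    show "(\<lambda>x. liminf (\<lambda>i. ennreal (norm (u i x - r x)))) \<in> borel_measurable M"
      by (intro borel_measurable_liminf borel_measurable_simple_function
          simple_function_compose2[OF u r])
    show "AE x in M. ennreal (norm (f x - r x)) = liminf (\<lambda>i. ennreal (norm (u i x - r x)))"
      using lim
    proof eventually_elim
      case (elim x)
      then have "(\<lambda>i. ennreal (norm (u i x - r x))) \<longlonglongrightarrow> ennreal (norm (f x - r x))"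
        by (intro tendsto_intros)
      from lim_imp_Liminf[OF sequentially_bot this] show ?case by simp
    qed
  qed
qed

text \<open>Null cells are exempt: a sample taken there has weight zero, so the values of
  \<open>f\<close> on the exceptional null set are harmless.\<close>

definition small_oscillation ::
  "'a measure \<Rightarrow> real \<Rightarrow> ('a \<Rightarrow> 'b::real_normed_vector) \<Rightarrow> 'a set set \<Rightarrow> bool" where
  "small_oscillation M \<delta> f P \<longleftrightarrow>
     (\<forall>D\<in>P. D \<in> null_sets M \<or> (\<forall>x\<in>D. \<forall>y\<in>D. norm (f x - f y) \<le> \<delta>))"

text \<open>Each cell of \<open>\<Gamma>\<close> lies inside a single cell of \<open>P\<close>: the
  cell of \<open>P\<close> through a point \<open>x\<close> of \<open>E\<close> is a union of cells
  of \<open>\<Gamma>\<close>, and the one containing \<open>x\<close> can only be \<open>E\<close>.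
  Both alternatives of the property pass to measurable subsets.\<close>

lemma small_oscillation_finer:
  assumes P: "measurable_partition M A P" and \<Gamma>: "measurable_partition M A \<Gamma>" "finer \<Gamma> P"
    and osc: "small_oscillation M \<delta> f P"
  shows "small_oscillation M \<delta> f \<Gamma>"
  unfolding small_oscillation_def
proof
  fix E assume E: "E \<in> \<Gamma>"
  have "E \<noteq> {}" using E \<Gamma>(1) by (auto simp: measurable_partition_def partition_on_def)
  then obtain x where x: "x \<in> E" by blast
  then have "x \<in> \<Union>P"
    using E P \<Gamma>(1) by (auto simp: measurable_partition_def partition_on_def)
  then obtain D where D: "D \<in> P" "x \<in> D" by blast
  then obtain G where G: "G \<subseteq> \<Gamma>" "D = \<Union>G" using \<Gamma>(2) unfolding finer_def by blast
  then obtain E' where "E' \<in> G" "x \<in> E'" using D(2) by blast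
  moreover have "E' = E"
    using E \<Gamma>(1) x G(1) calculation disjointD[of \<Gamma> E E']
    by (auto simp: measurable_partition_def partition_on_def)
  ultimately have "E \<subseteq> D" using G(2) by blast
  moreover have "E \<in> sets M" using E \<Gamma>(1) by (auto simp: measurable_partition_def)
  ultimately show "E \<in> null_sets M \<or> (\<forall>x\<in>E. \<forall>y\<in>E. norm (f x - f y) \<le> \<delta>)"
    using osc D(1) null_sets_subset[of D M E] unfolding small_oscillation_def by blast
qed

text \<open>The approximating simple functions take countably many values in all, and off a null set
  every \<open>f x\<close> is a limit of such values. Preimages of the balls of radius
  \<open>\<delta> / 2\<close> about these values therefore cover the rest of the space; making them
  disjoint gives the partition.\<close>

lemma strongly_measurable_imp_small_oscillation:
  fixes f :: "'a \<Rightarrow> 'b::banach"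
  assumes f: "strongly_measurable M f" and \<delta>: "\<delta> > 0"
  obtains P where "measurable_partition M (space M) P" "small_oscillation M \<delta> f P"
proof -
  obtain u where u: "\<And>i. simple_function M (u i)" and lim: "AE x in M. (\<lambda>i. u i x) \<longlonglongrightarrow> f x"
    using f unfolding strongly_measurable_def by blast
  obtain N where N: "N \<in> null_sets M" and lim: "\<And>x. x \<in> space M - N \<Longrightarrow> (\<lambda>i. u i x) \<longlonglongrightarrow> f x"
    using lim by (rule AE_E3) blast
  have NM: "N \<in> sets M" using N by auto
  define C where "C = (\<Union>i. u i ` space M)"
  have C: "countable C"
    unfolding C_def using u by (auto simp: simple_function_def intro: countable_finite)
  define A where
    "A n = {x \<in> space M - N. norm (f x - from_nat_into C n) < \<delta> / 2}" for n
  have A_sets: "A n \<in> sets M" for n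
  proof -
    let ?c = "from_nat_into C n"
    \<comment> \<open>The value \<open>\<delta>\<close> on \<open>N\<close> makes the approximants
      converge everywhere on the space, so that \<open>?h\<close> is measurable, and it exceeds the
      threshold \<open>\<delta> / 2\<close>, so that \<open>N\<close> stays outside the sublevel
      set.\<close>
    let ?h = "\<lambda>x. if x \<in> N then \<delta> else norm (f x - ?c)"
    have "?h \<in> borel_measurable M"
    proof (rule borel_measurable_LIMSEQ_real)
      show "(\<lambda>i. if x \<in> N then \<delta> else norm (u i x - ?c)) \<longlonglongrightarrow> ?h x" if "x \<in> space M" for x
        using lim[of x] that by (auto intro!: tendsto_intros)
      show "(\<lambda>x. if x \<in> N then \<delta> else norm (u i x - ?c)) \<in> borel_measurable M" for i
      proof (intro measurable_If_set)
        show "(\<lambda>x. norm (u i x - ?c)) \<in> borel_measurable M"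
          by (intro borel_measurable_simple_function simple_function_compose1[OF u])
      qed (use NM in auto)
    qed
    then have "{x \<in> space M. ?h x < \<delta> / 2} \<in> sets M" by simp
    also have "{x \<in> space M. ?h x < \<delta> / 2} = A n"
      using \<delta> by (auto simp: A_def split: if_splits)
    finally show ?thesis .
  qed
  have A_cover: "(\<Union>n. A n) = space M - N"
  proof
    show "space M - N \<subseteq> (\<Union>n. A n)"
    proof
      fix x assume x: "x \<in> space M - N"
      obtain i where "norm (u i x - f x) < \<delta> / 2"
        using LIMSEQ_D[OF lim[OF x], of "\<delta> / 2"] \<delta> by auto
      moreover have "u i x \<in> C" using x by (auto simp: C_def)
      then obtain n where "from_nat_into C n = u i x"
        using C by (metis from_nat_into_to_nat_on)
      ultimately have "x \<in> A n" using x by (simp add: A_def norm_minus_commute)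
      then show "x \<in> (\<Union>n. A n)" by blast
    qed
  qed (auto simp: A_def)
  define P where "P = insert N (range (disjointed A)) - {{}}"
  have disjointed_A: "disjointed A n \<subseteq> A n" for n by (rule disjointed_subset)
  show thesis
  proof
    show "measurable_partition M (space M) P"
      unfolding measurable_partition_def
    proof (intro conjI)
      show "countable P" by (auto simp: P_def)
      show "P \<subseteq> sets M"
        using NM sets.range_disjointed_sets[of A M] A_sets by (auto simp: P_def)
      show "partition_on (space M) P"
      proof (rule partition_onI)
        have "\<Union>P = N \<union> (\<Union>n. disjointed A n)" by (auto simp: P_def)
        also have "\<dots> = space M"
          using A_cover sets.sets_into_space[OF NM] by (auto simp: UN_disjointed_eq)
        finally show "\<Union>P = space M" .
        fix p q assume pq: "p \<in> P" "q \<in> P" "p \<noteq> q"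
        have N_dis: "disjnt N (disjointed A n)" for n
          using disjointed_A[of n] by (auto simp: A_def disjnt_def)
        have A_dis: "disjnt (disjointed A m) (disjointed A n)" if "m \<noteq> n" for m n
          using disjoint_family_disjointed[of A] that by (auto simp: disjoint_family_on_def disjnt_def)
        consider "p = N" "q = N" | n where "p = N" "q = disjointed A n"
          | m where "p = disjointed A m" "q = N"
          | m n where "p = disjointed A m" "q = disjointed A n"
          using pq(1,2) unfolding P_def by blast
        then show "disjnt p q"
        proof cases
          case 4
          with pq(3) have "m \<noteq> n" by blast
          with 4 A_dis show ?thesis by simp
        qed (use pq(3) N_dis in \<open>simp_all add: disjnt_sym\<close>)
      qed (auto simp: P_def)
    qed
    show "small_oscillation M \<delta> f P"
      unfolding small_oscillation_def
    proof
      fix D assume "D \<in> P"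
      then consider "D = N" | n where "D = disjointed A n" by (auto simp: P_def)
      then show "D \<in> null_sets M \<or> (\<forall>x\<in>D. \<forall>y\<in>D. norm (f x - f y) \<le> \<delta>)"
      proof cases
        case 2
        have "norm (f x - f y) \<le> \<delta>" if "x \<in> A n" "y \<in> A n" for x y
          using that norm_triangle_ineq4[of "f x - from_nat_into C n" "f y - from_nat_into C n"]
          by (simp add: A_def)
        with 2 disjointed_A show ?thesis by blast
      qed (use N in simp)
    qed
  qed
qed

section \<open>Riemann sums compared with integrals of simple functions\<close>

text \<open>Both quantities are sums over the cells of \<open>\<Gamma>\<close>, so they can be
  compared cell by cell. The error on a cell is at most its measure under the finite measure
  \<open>\<nu>\<close> with density \<open>g + \<delta>\<close>, and countable additivity of
  \<open>\<nu>\<close> adds up the errors. Absolute summability follows because the part coming from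
  \<open>s\<close> is absolutely summable as well.\<close>

lemma (in finite_measure) RL_sum_simple_bochner_integral_dist_le:
  fixes f :: "'a \<Rightarrow> 'b::banach"
  assumes f: "strongly_measurable M f"
    and \<Gamma>: "measurable_partition M (space M) \<Gamma>" and osc: "small_oscillation M \<delta> f \<Gamma>"
    and t: "sampling \<Gamma> t"
    and s: "simple_function M s" and fin: "(\<integral>\<^sup>+x. norm (f x - s x) \<partial>M) < \<infinity>" and \<delta>: "\<delta> \<ge> 0"
  shows "(\<lambda>D. measure M D *\<^sub>R f (t D)) abs_summable_on \<Gamma>"
    and "norm (RL_sum M f \<Gamma> t - Bochner_Integration.simple_bochner_integral M s) \<le>
      enn2real (\<integral>\<^sup>+x. norm (f x - s x) \<partial>M) + \<delta> * measure M (space M)"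
proof -
  obtain g where g[measurable]: "g \<in> borel_measurable M"
    and g_eq: "AE x in M. ennreal (norm (f x - s x)) = g x"
    using strongly_measurable_norm_diff_AE_eq[OF f s] by blast
  have int_g: "(\<integral>\<^sup>+x. norm (f x - s x) \<partial>M) = (\<integral>\<^sup>+x. g x \<partial>M)"
    by (rule nn_integral_cong_AE[OF g_eq])
  have \<Gamma>_sets: "\<And>D. D \<in> \<Gamma> \<Longrightarrow> D \<in> sets M"
    and \<Gamma>_Union: "\<Union>\<Gamma> = space M"
    using \<Gamma> by (auto simp: measurable_partition_def partition_on_def)
  define Y where "Y = s ` space M"
  define B where "B y = {x \<in> space M. s x = y}" for y
  have Y: "finite Y" using s by (simp add: Y_def simple_function_def)
  have B_sets: "B y \<in> sets M" for y
  proof -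
    have "s -` {y} \<inter> space M \<in> sets M" by (rule simple_functionD(2)[OF s])
    also have "s -` {y} \<inter> space M = B y" by (auto simp: B_def)
    finally show ?thesis .
  qed
  \<comment> \<open>\<open>a D\<close> is the Riemann term of the cell, \<open>J D\<close> the
    integral of \<open>s\<close> over it.\<close>
  define a where "a D = measure M D *\<^sub>R f (t D)" for D
  define J where "J D = (\<Sum>y\<in>Y. measure M (D \<inter> B y) *\<^sub>R y)" for D

  \<comment> \<open>\<open>s\<close> has finitely many values, so the sum over values may be
    exchanged with the sum over cells.\<close>
  have J_sum: "(J has_sum Bochner_Integration.simple_bochner_integral M s) \<Gamma>"
    unfolding J_def Bochner_Integration.simple_bochner_integral_def Y_def[symmetric]
      B_def[symmetric]
    by (intro has_sum_sum has_sum_measure_partition_Int[OF \<Gamma>] B_sets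
        has_sum_bounded_linear[OF bounded_linear_scaleR_left])
  have J_abs: "J abs_summable_on \<Gamma>"
  proof (rule Infinite_Sum.abs_summable_on_comparison_test')
    have "((\<lambda>D. \<Sum>y\<in>Y. measure M (D \<inter> B y) * norm y) has_sum (\<Sum>y\<in>Y. measure M (B y) * norm y)) \<Gamma>"
      by (intro has_sum_sum has_sum_cmult_left has_sum_measure_partition_Int[OF \<Gamma>] B_sets)
    then show "(\<lambda>D. \<Sum>y\<in>Y. measure M (D \<inter> B y) * norm y) summable_on \<Gamma>"
      by (rule has_sum_imp_summable)
    show "norm (J D) \<le> (\<Sum>y\<in>Y. measure M (D \<inter> B y) * norm y)" for D
      unfolding J_def by (rule order_trans[OF norm_sum]) simp
  qed

  define \<nu> where "\<nu> = density M (\<lambda>x. g x + ennreal \<delta>)"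
  have sets_\<nu>: "sets \<nu> = sets M" and space_\<nu>: "space \<nu> = space M" by (simp_all add: \<nu>_def)
  have \<nu>_space: "emeasure \<nu> (space M) = (\<integral>\<^sup>+x. g x \<partial>M) + ennreal \<delta> * emeasure M (space M)"
    by (simp add: \<nu>_def emeasure_density nn_integral_add cong: nn_integral_cong_simp)
  interpret \<nu>: finite_measure \<nu>
    using fin by (intro finite_measureI)
      (simp add: space_\<nu> \<nu>_space int_g ennreal_mult_eq_top_iff emeasure_finite)
  have \<nu>_sum: "(measure \<nu> has_sum measure \<nu> (space M)) \<Gamma>"
    using \<nu>.has_sum_measure_disjoint[of \<Gamma>] \<Gamma>
    by (auto simp: measurable_partition_def partition_on_def sets_\<nu>)
  have \<nu>_real: "measure \<nu> (space M) = enn2real (\<integral>\<^sup>+x. norm (f x - s x) \<partial>M) + \<delta> * measure M (space M)"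
  proof -
    have "ennreal \<delta> * emeasure M (space M) < top"
      by (simp add: ennreal_mult_less_top emeasure_eq_measure)
    then show ?thesis
      using fin \<delta> by (simp add: measure_def \<nu>_space int_g enn2real_plus enn2real_mult)
  qed

  have diff_le: "norm (a D - J D) \<le> measure \<nu> D" if D: "D \<in> \<Gamma>" for D
  proof -
    have D_sets[measurable]: "D \<in> sets M" by (rule \<Gamma>_sets[OF D])
    have tD: "t D \<in> D" using t D by (simp add: sampling_def)
    have "D \<subseteq> space M" using D_sets by (rule sets.sets_into_space)
    then have D_eq: "D = (\<Union>y\<in>Y. D \<inter> B y)" by (auto simp: Y_def B_def)
    \<comment> \<open>Cutting \<open>D\<close> along the level sets of \<open>s\<close> puts
      \<open>a D\<close> and \<open>J D\<close> over the same pieces, on each of which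
      \<open>f (t D) - y\<close> is constant.\<close>
    have "measure M D = (\<Sum>y\<in>Y. measure M (D \<inter> B y))"
      by (subst D_eq, rule finite_measure_finite_Union)
        (use Y B_sets in \<open>auto simp: disjoint_family_on_def B_def\<close>)
    then have "a D - J D = (\<Sum>y\<in>Y. measure M (D \<inter> B y) *\<^sub>R (f (t D) - y))"
      by (simp add: a_def J_def scaleR_sum_left scaleR_diff_right sum_subtractf)
    then have "norm (a D - J D) \<le> (\<Sum>y\<in>Y. measure M (D \<inter> B y) * norm (f (t D) - y))"
      using norm_sum[of "\<lambda>y. measure M (D \<inter> B y) *\<^sub>R (f (t D) - y)" Y] by simp
    also have "\<dots> \<le> (\<Sum>y\<in>Y. measure \<nu> (D \<inter> B y))"
    proof (rule sum_mono)
      fix y assume "y \<in> Y"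
      define E where "E = D \<inter> B y"
      have E[measurable]: "E \<in> sets M" using D_sets B_sets by (auto simp: E_def)
      \<comment> \<open>On a null cell the indicator vanishes almost everywhere. Otherwise pass
        through \<open>f x\<close>: it is within \<open>\<delta>\<close> of \<open>f (t D)\<close>,
        and its distance from \<open>y = s x\<close> is almost everywhere
        \<open>g x\<close>.\<close>
      have AE_le: "AE x in M. ennreal (norm (f (t D) - y)) * indicator E x \<le>
          (g x + ennreal \<delta>) * indicator E x"
      proof (cases "D \<in> null_sets M")
        case True
        then have "AE x in M. x \<notin> E"
          by (intro AE_not_in null_sets_subset[OF True]) (auto simp: E_def B_sets)
        then show ?thesis by eventually_elim simp
      next
        case False
        with osc D have o: "norm (f x - f x') \<le> \<delta>" if "x \<in> D" "x' \<in> D" for x x'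
          using that unfolding small_oscillation_def by blast
        show ?thesis using g_eq
        proof eventually_elim
          case (elim x)
          have "norm (f (t D) - y) \<le> norm (f x - s x) + \<delta>" if "x \<in> E"
          proof -
            have "x \<in> D" "s x = y" using that by (auto simp: E_def B_def)
            with o[OF tD, of x] norm_triangle_ineq[of "f x - y" "f (t D) - f x"]
            show ?thesis by simp
          qed
          then show ?case
            using \<delta> by (auto simp: indicator_def simp flip: elim ennreal_plus intro!: ennreal_leI)
        qed
      qed
      have "ennreal (measure M E * norm (f (t D) - y)) =
          (\<integral>\<^sup>+x. ennreal (norm (f (t D) - y)) * indicator E x \<partial>M)"
        by (simp add: nn_integral_cmult_indicator emeasure_eq_measure ennreal_mult'
            flip: mult.commute[of "norm (f (t D) - y)"])
      also have "\<dots> \<le> (\<integral>\<^sup>+x. (g x + ennreal \<delta>) * indicator E x \<partial>M)"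
        by (rule nn_integral_mono_AE[OF AE_le])
      also have "\<dots> = ennreal (measure \<nu> E)"
        by (simp add: \<nu>.emeasure_eq_measure[symmetric]) (simp add: \<nu>_def emeasure_density)
      finally show "measure M (D \<inter> B y) * norm (f (t D) - y) \<le> measure \<nu> (D \<inter> B y)"
        by (simp add: E_def)
    qed
    also have "\<dots> = measure \<nu> D"
      by (subst (2) D_eq, rule \<nu>.finite_measure_finite_Union[symmetric])
        (use Y B_sets D_sets in \<open>auto simp: disjoint_family_on_def B_def sets_\<nu>\<close>)
    finally show ?thesis .
  qed
  have diff_abs: "(\<lambda>D. a D - J D) abs_summable_on \<Gamma>"
    by (rule Infinite_Sum.abs_summable_on_comparison_test'[OF has_sum_imp_summable[OF \<nu>_sum] diff_le])
  have a_abs: "a abs_summable_on \<Gamma>"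
  proof (rule Infinite_Sum.abs_summable_on_comparison_test'[OF summable_on_add[OF diff_abs J_abs]])
    show "norm (a D) \<le> norm (a D - J D) + norm (J D)" for D
      using norm_triangle_ineq[of "a D - J D" "J D"] by simp
  qed
  then show "(\<lambda>D. measure M D *\<^sub>R f (t D)) abs_summable_on \<Gamma>" unfolding a_def .
  have "(a has_sum RL_sum M f \<Gamma> t) \<Gamma>"
    using abs_summable_summable[OF a_abs] unfolding RL_sum_def a_def by (rule has_sum_infsum)
  then have diff_sum: "((\<lambda>D. a D - J D) has_sum
      RL_sum M f \<Gamma> t - Bochner_Integration.simple_bochner_integral M s) \<Gamma>"
    using has_sum_add[OF _ has_sum_bounded_linear[OF bounded_linear_minus[OF bounded_linear_ident] J_sum]]
    by simp
  \<comment> \<open>The norm of the total difference is at most the sum of the cell errors, hence at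
    most the \<open>\<nu>\<close>-measure of the space.\<close>
  from has_sum_mono[OF has_sum_infsum[OF diff_abs] \<nu>_sum diff_le]
    norm_has_sum_bound[OF has_sum_infsum[OF diff_abs] diff_sum]
  show "norm (RL_sum M f \<Gamma> t - Bochner_Integration.simple_bochner_integral M s) \<le>
      enn2real (\<integral>\<^sup>+x. norm (f x - s x) \<partial>M) + \<delta> * measure M (space M)"
    by (simp add: \<nu>_real)
qed

section \<open>Passage to the limit along an approximating sequence\<close>

text \<open>The partition \<open>P\<close> depends on \<open>f\<close> and \<open>\<delta>\<close>
  but not on the index of the approximating sequence. So \<open>\<Gamma>\<close> and
  \<open>t\<close> can be fixed first and the index sent to infinity afterwards.\<close>

lemma (in finite_measure) bochner_integrable_imp_has_RL_integral:
  fixes f :: "'a \<Rightarrow> 'b::banach"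
  assumes "bochner_integrable M f"
  shows "has_RL_integral M (space M) f (bochner_integral M f)"
  unfolding has_RL_integral_def
proof (intro allI impI)
  fix \<epsilon> :: real assume \<epsilon>: "\<epsilon> > 0"
  obtain s where f: "strongly_measurable M f" and s: "bochner_approx M f s"
    using assms unfolding bochner_integrable_def by blast
  \<comment> \<open>The added 1 allows for a space of measure zero and makes the bound strictly less
    than \<open>\<epsilon>\<close>; the limit below yields only a weak inequality.\<close>
  define \<delta> where "\<delta> = \<epsilon> / (measure M (space M) + 1)"
  have pos: "measure M (space M) + 1 > 0" by (simp add: add_nonneg_pos)
  have \<delta>: "\<delta> > 0" and \<delta>_less: "\<delta> * measure M (space M) < \<epsilon>"
    using \<epsilon> pos by (simp_all add: \<delta>_def field_simps)
  obtain P where P: "measurable_partition M (space M) P" and osc: "small_oscillation M \<delta> f P"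
    using strongly_measurable_imp_small_oscillation[OF f \<delta>] by blast
  let ?E = "\<lambda>i. \<integral>\<^sup>+x. ennreal (norm (f x - s i x)) \<partial>M"
  have simple: "simple_function M (s i)" for i
    using s by (auto simp: bochner_approx_def elim: simple_bochner_integrable.cases)
  have E: "?E \<longlonglongrightarrow> 0" using s by (simp add: bochner_approx_def)
  \<comment> \<open>Early approximation errors may be infinite, and the estimate requires a finite
    one. A single good index gives absolute summability, and a tail of them gives the limit.\<close>
  then have E_fin: "eventually (\<lambda>i. ?E i < \<infinity>) sequentially"
    by (intro order_tendstoD(2)[of _ 0]) auto
  have "(\<lambda>D. measure M D *\<^sub>R f (t D)) abs_summable_on \<Gamma> \<and>
      norm (RL_sum M f \<Gamma> t - bochner_integral M f) < \<epsilon>"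
    if \<Gamma>: "measurable_partition M (space M) \<Gamma>" "finer \<Gamma> P" and t: "sampling \<Gamma> t" for \<Gamma> t
  proof
    note est = RL_sum_simple_bochner_integral_dist_le
      [OF f \<Gamma>(1) small_oscillation_finer[OF P \<Gamma> osc] t simple _ less_imp_le[OF \<delta>]]
    obtain i where "?E i < \<infinity>" using E_fin by (auto simp: eventually_sequentially)
    then show "(\<lambda>D. measure M D *\<^sub>R f (t D)) abs_summable_on \<Gamma>" by (rule est(1))
    have "norm (RL_sum M f \<Gamma> t - bochner_integral M f) \<le> 0 + \<delta> * measure M (space M)"
    proof (rule tendsto_le[OF sequentially_bot])
      show "(\<lambda>i. enn2real (?E i) + \<delta> * measure M (space M)) \<longlonglongrightarrow> 0 + \<delta> * measure M (space M)"
        using E by (intro tendsto_add tendsto_const tendsto_enn2real) simp_all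
      show "(\<lambda>i. norm (RL_sum M f \<Gamma> t - Bochner_Integration.simple_bochner_integral M (s i)))
          \<longlonglongrightarrow> norm (RL_sum M f \<Gamma> t - bochner_integral M f)"
        by (intro tendsto_intros bochner_integral_tendsto[OF f s])
      show "\<forall>\<^sub>F i in sequentially.
          norm (RL_sum M f \<Gamma> t - Bochner_Integration.simple_bochner_integral M (s i)) \<le>
          enn2real (?E i) + \<delta> * measure M (space M)"
        using E_fin by eventually_elim (rule est(2))
    qed
    with \<delta>_less show "norm (RL_sum M f \<Gamma> t - bochner_integral M f) < \<epsilon>" by simp
  qed
  with P show "\<exists>P. measurable_partition M (space M) P \<and>
      (\<forall>\<Gamma> t. measurable_partition M (space M) \<Gamma> \<and> finer \<Gamma> P \<and> sampling \<Gamma> t \<longrightarrow>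
        (\<lambda>D. measure M D *\<^sub>R f (t D)) abs_summable_on \<Gamma> \<and>
        norm (RL_sum M f \<Gamma> t - bochner_integral M f) < \<epsilon>)"
    by blast
qed

theorem theorem15:
  fixes M :: "'a measure" and f :: "'a \<Rightarrow> 'b::banach"
  assumes "finite_measure M"
    and "bochner_integrable M f"
  shows "RL_integrable M (space M) f \<and>
         RL_integral M (space M) f = bochner_integral M f"
  using finite_measure.bochner_integrable_imp_has_RL_integral[OF assms]
  by (auto simp: RL_integrable_def intro: RL_integral_eqI)

end
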